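(* If $G$ is a permutation graph, then its oriented star-conflict graph $A_G$ is a cocomparability graph.
   Context: All graphs are finite, simple and undirected. A graph $G$ is a permutation graph if there are two linear orders $<_1,<_2$ on $V(G)$ such that two vertices are adjacent precisely when they occur in opposite orders in $<_1$ and $<_2$. An orientation of a graph is transitive if $x\to y$ and $y\to z$ imply that $xz$ is an edge oriented as $x\to z$. A graph is a comparability graph if it admits a transitive orientation, and a cocomparability graph if its complement is a comparability graph. The oriented star-conflict graph $A_G$ has vertex set $V(A_G)=\{(c,\ell): c\ell\in E(G)\}$, the set of ordered edges of $G$ (each edge gives two ordered edges). Two distinct ordered edges $(c,\ell)$ and $(d,r)$ are compatible if either (same centre) $c=d$, $\ell\ne r$ and $\ell r\notin E(G)$; or (different centres) $c\neq d$, the four vertices $c,\ell,d,r$ are distinct, and $cd,cr,\ell d,\ell r\notin E(G)$. Two distinct vertices of $A_G$ are adjacent if and only if the corresponding ordered edges are not compatible. *)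

theory Defs
  imports "Graph_Theory.Pair_Digraph"
begin

text \<open>
  A finite simple undirected graph is a \<^locale>\<open>pair_graph\<close>: \<^term>\<open>parcs G\<close> is a symmetric
  irreflexive relation on the finite set \<^term>\<open>pverts G\<close>. An edge \<open>uv\<close> is thus represented by
  both \<open>(u, v)\<close> and \<open>(v, u)\<close>, so \<^term>\<open>parcs G\<close> is exactly the set of ordered edges of \<open>G\<close>.
\<close>

definition permutation_graph :: "'a pair_pre_digraph \<Rightarrow> bool" where
  "permutation_graph G \<longleftrightarrow> pair_graph G \<and>
     (\<exists>r1 r2. linear_order_on (pverts G) r1 \<and> linear_order_on (pverts G) r2 \<and>
        (\<forall>u \<in> pverts G. \<forall>v \<in> pverts G. u \<noteq> v \<longrightarrow>
           ((u, v) \<in> parcs G \<longleftrightarrow>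
              ((u, v) \<in> r1 \<and> (v, u) \<in> r2) \<or> ((v, u) \<in> r1 \<and> (u, v) \<in> r2))))"

text \<open>An orientation chooses exactly one of the two arcs \<open>(u, v)\<close>, \<open>(v, u)\<close> of each edge.\<close>

definition orientation :: "'a pair_pre_digraph \<Rightarrow> ('a \<times> 'a) set \<Rightarrow> bool" where
  "orientation G D \<longleftrightarrow> D \<union> D\<inverse> = parcs G \<and> D \<inter> D\<inverse> = {}"

definition comparability_graph :: "'a pair_pre_digraph \<Rightarrow> bool" where
  "comparability_graph G \<longleftrightarrow> pair_graph G \<and> (\<exists>D. orientation G D \<and> trans D)"

definition complement_graph :: "'a pair_pre_digraph \<Rightarrow> 'a pair_pre_digraph" where
  "complement_graph G =
     \<lparr> pverts = pverts G,
       parcs = {(u, v). u \<in> pverts G \<and> v \<in> pverts G \<and> u \<noteq> v \<and> (u, v) \<notin> parcs G} \<rparr>"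

definition cocomparability_graph :: "'a pair_pre_digraph \<Rightarrow> bool" where
  "cocomparability_graph G \<longleftrightarrow> pair_graph G \<and> comparability_graph (complement_graph G)"

fun compatible :: "'a pair_pre_digraph \<Rightarrow> 'a \<times> 'a \<Rightarrow> 'a \<times> 'a \<Rightarrow> bool" where
  "compatible G (c, l) (d, r) \<longleftrightarrow>
     (c = d \<and> l \<noteq> r \<and> (l, r) \<notin> parcs G) \<or>
     (c \<noteq> d \<and> distinct [c, l, d, r] \<and>
        (c, d) \<notin> parcs G \<and> (c, r) \<notin> parcs G \<and> (l, d) \<notin> parcs G \<and> (l, r) \<notin> parcs G)"

definition star_conflict_graph :: "'a pair_pre_digraph \<Rightarrow> ('a \<times> 'a) pair_pre_digraph" where
  "star_conflict_graph G =
     \<lparr> pverts = parcs G,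
       parcs = {(e, f). e \<in> parcs G \<and> f \<in> parcs G \<and> e \<noteq> f \<and> \<not> compatible G e f} \<rparr>"

end

theory Submission
  imports Defs
begin

text \<open>
  Write \<open>x < y\<close> if \<open>x\<close> precedes \<open>y\<close> in both linear orders; two distinct vertices of a permutation
  graph are non-adjacent iff they are comparable in this strict partial order. If the edges
  \<open>(c, l)\<close> and \<open>(d, r)\<close> are compatible with \<open>c \<noteq> d\<close>, all four cross pairs are comparable, and they
  are all ordered in the same direction, since \<open>c\<close>, \<open>l\<close> are incomparable and so are \<open>d\<close>, \<open>r\<close>.
  Hence orienting compatible edges by the order of their leaves \<open>l\<close>, \<open>r\<close> is transitive.
\<close>

text \<open>The locale \<open>pair_graph\<close> asks for symmetry via \<open>with_proj\<close>;
  this turns it into a plain property of a relation.\<close>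

lemma symmetric_with_proj: "symmetric (with_proj H) \<longleftrightarrow> sym (parcs H)"
proof -
  have "arcs_ends (with_proj H) = parcs H"
    by (force simp: arcs_ends_def arc_to_ends_def)
  then show ?thesis
    by (simp add: symmetric_def)
qed

lemma (in pair_graph) pair_graph_complement_graph: "pair_graph (complement_graph G)"
proof unfold_locales
  show "finite (parcs (complement_graph G))"
    by (rule finite_subset[of _ "pverts G \<times> pverts G"]) (auto simp: complement_graph_def)
qed (auto simp: symmetric_with_proj complement_graph_def sym_def dest: arcs_symmetric)

lemma (in pair_graph) compatible_sym: "compatible G e f \<longleftrightarrow> compatible G f e"
  using arcs_symmetric by (cases e; cases f) auto

lemma (in pair_graph) pair_graph_star_conflict_graph: "pair_graph (star_conflict_graph G)"
proof unfold_locales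
  show "finite (parcs (star_conflict_graph G))"
    by (rule finite_subset[of _ "parcs G \<times> parcs G"]) (auto simp: star_conflict_graph_def)
  show "symmetric (with_proj (star_conflict_graph G))"
    unfolding symmetric_with_proj
    using compatible_sym
    by (auto intro!: symI simp: star_conflict_graph_def simp del: compatible.simps)
qed (auto simp: star_conflict_graph_def)

lemma parcs_complement_star_conflict_graph:
  "parcs (complement_graph (star_conflict_graph G)) =
     {(e, f). e \<in> parcs G \<and> f \<in> parcs G \<and> e \<noteq> f \<and> compatible G e f}"
  by (auto simp: complement_graph_def star_conflict_graph_def)

lemma permutation_graph_strict_order:
  assumes "permutation_graph G"
  obtains P where "trans P" "irrefl P"
    "\<And>u v. u \<in> pverts G \<Longrightarrow> v \<in> pverts G \<Longrightarrow> u \<noteq> v \<Longrightarrow>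
       (u, v) \<in> parcs G \<longleftrightarrow> (u, v) \<notin> P \<and> (v, u) \<notin> P"
proof -
  obtain r1 r2 where lin: "linear_order_on (pverts G) r1" "linear_order_on (pverts G) r2"
    and arcs: "\<And>u v. u \<in> pverts G \<Longrightarrow> v \<in> pverts G \<Longrightarrow> u \<noteq> v \<Longrightarrow> (u, v) \<in> parcs G \<longleftrightarrow>
       ((u, v) \<in> r1 \<and> (v, u) \<in> r2) \<or> ((v, u) \<in> r1 \<and> (u, v) \<in> r2)"
    using assms unfolding permutation_graph_def by blast
  have r: "trans r1" "trans r2" "antisym r1" "antisym r2"
    "total_on (pverts G) r1" "total_on (pverts G) r2"
    using lin by (auto simp: order_on_defs)
  show thesis
  proof (rule that)
    \<comment> \<open>Linear orders here are reflexive, hence \<open>- Id\<close>. By antisymmetry a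
      chain of two strict steps cannot return to its start.\<close>
    show "trans (r1 \<inter> r2 - Id)"
      using r(1-4) by (auto simp: trans_def antisym_def; blast)
    show "irrefl (r1 \<inter> r2 - Id)"
      by (auto simp: irrefl_def)
    fix u v
    assume "u \<in> pverts G" "v \<in> pverts G" "u \<noteq> v"
    with arcs[of u v] r(3-6)
    show "(u, v) \<in> parcs G \<longleftrightarrow> (u, v) \<notin> r1 \<inter> r2 - Id \<and> (v, u) \<notin> r1 \<inter> r2 - Id"
      unfolding total_on_def antisym_def by blast
  qed
qed

text \<open>Distinctness of the four vertices is left implicit: it follows once \<open>P\<close> is
  irreflexive and \<open>G\<close> has no loops.\<close>

definition leaf_orientation ::
    "'a pair_pre_digraph \<Rightarrow> ('a \<times> 'a) set \<Rightarrow> (('a \<times> 'a) \<times> 'a \<times> 'a) set" where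
  "leaf_orientation G P =
    {((c, l), (d, r)). (c, l) \<in> parcs G \<and> (d, r) \<in> parcs G \<and> (l, r) \<in> P \<and>
       (c = d \<or> (c, d) \<in> P \<and> (c, r) \<in> P \<and> (l, d) \<in> P)}"

text \<open>When only one of the two steps changes the centre, the missing cross pair is obtained
  through the middle leaf \<open>r\<close>: \<open>(l, e)\<close> if \<open>c = d\<close>, and
  \<open>(c, s)\<close> if \<open>d = e\<close>.\<close>

lemma trans_leaf_orientation:
  assumes "trans P"
  shows "trans (leaf_orientation G P)"
proof (rule transI, clarify)
  fix c l d r e s
  assume "((c, l), (d, r)) \<in> leaf_orientation G P" "((d, r), (e, s)) \<in> leaf_orientation G P"
  then show "((c, l), (e, s)) \<in> leaf_orientation G P"
    using transD[OF assms] unfolding leaf_orientation_def by blast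
qed

lemma (in pair_graph) orientation_leaf_orientation:
  assumes "trans P" "irrefl P"
    and arcs: "\<And>u v. u \<in> pverts G \<Longrightarrow> v \<in> pverts G \<Longrightarrow> u \<noteq> v \<Longrightarrow>
       (u, v) \<in> parcs G \<longleftrightarrow> (u, v) \<notin> P \<and> (v, u) \<notin> P"
  shows "orientation (complement_graph (star_conflict_graph G)) (leaf_orientation G P)"
proof -
  let ?D = "leaf_orientation G P"
  note tr = transD[OF \<open>trans P\<close>]
  have irr: "(x, x) \<notin> P" for x
    using \<open>irrefl P\<close> by (auto simp: irrefl_def)
  have loop: "(x, x) \<notin> parcs G" for x
    using no_loops' by blast
  \<comment> \<open>\<open>P\<close> may relate elements outside \<open>pverts G\<close>, but the
    ends of an arc are always distinct vertices.\<close>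
  have nadj: "(u, v) \<notin> parcs G" if "(u, v) \<in> P \<or> (v, u) \<in> P" for u v
    using that arcs in_arcsD1 in_arcsD2 no_loops' by metis
  have comp: "(u, v) \<in> P \<or> (v, u) \<in> P"
    if "(u, v) \<notin> parcs G" "u \<in> pverts G" "v \<in> pverts G" "u \<noteq> v" for u v
    using that arcs by blast
  have "((c, l), (d, r)) \<in> ?D \<union> ?D\<inverse> \<longleftrightarrow>
      (c, l) \<in> parcs G \<and> (d, r) \<in> parcs G \<and> (c, l) \<noteq> (d, r) \<and> compatible G (c, l) (d, r)"
    (is "?L \<longleftrightarrow> ?R") for c l d r
  proof
    assume ?L
    then show ?R
      using nadj irr loop by (auto simp: leaf_orientation_def)
  next
    assume R: ?R
    then have E: "(c, l) \<in> parcs G" "(d, r) \<in> parcs G"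
      and V: "c \<in> pverts G" "l \<in> pverts G" "d \<in> pverts G" "r \<in> pverts G"
      by (auto dest: in_arcsD1 in_arcsD2)
    have inc: "(c, l) \<notin> P" "(l, c) \<notin> P" "(d, r) \<notin> P" "(r, d) \<notin> P"
      using E nadj by blast+
    show ?L
    proof (cases "c = d")
      case True
      then show ?thesis
        using R E V comp[of l r] by (auto simp: leaf_orientation_def)
    next
      case False
      then have "(c, d) \<in> P \<or> (d, c) \<in> P" "(c, r) \<in> P \<or> (r, c) \<in> P"
        "(l, d) \<in> P \<or> (d, l) \<in> P" "(l, r) \<in> P \<or> (r, l) \<in> P"
        using R V comp by auto
      \<comment> \<open>Opposite directions would compose at a shared vertex: \<open>(r, c)\<close>
        and \<open>(c, d)\<close> in \<open>P\<close>, for instance, would give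
        \<open>(r, d)\<close>, against \<open>inc\<close>.\<close>
      then have "(c, d) \<in> P \<and> (c, r) \<in> P \<and> (l, d) \<in> P \<and> (l, r) \<in> P \<or>
        (d, c) \<in> P \<and> (r, c) \<in> P \<and> (d, l) \<in> P \<and> (r, l) \<in> P"
        using inc tr by meson
      then show ?thesis
        using E by (auto simp: leaf_orientation_def)
    qed
  qed
  then have "?D \<union> ?D\<inverse> = parcs (complement_graph (star_conflict_graph G))"
    unfolding parcs_complement_star_conflict_graph
    by (simp add: set_eq_iff split_paired_All del: compatible.simps)
  \<comment> \<open>An arc in both directions would put \<open>(l, r)\<close> and
    \<open>(r, l)\<close> into \<open>P\<close>, hence \<open>(l, l)\<close>.\<close>
  moreover have "?D \<inter> ?D\<inverse> = {}"
    using tr irr by (auto simp: leaf_orientation_def; blast)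
  ultimately show ?thesis
    by (simp add: orientation_def)
qed

theorem theorem5:
  fixes G :: "'a pair_pre_digraph"
  assumes "permutation_graph G"
  shows "cocomparability_graph (star_conflict_graph G)"
proof -
  interpret pair_graph G
    using assms by (simp add: permutation_graph_def)
  obtain P where "trans P" "irrefl P"
    "\<And>u v. u \<in> pverts G \<Longrightarrow> v \<in> pverts G \<Longrightarrow> u \<noteq> v \<Longrightarrow>
       (u, v) \<in> parcs G \<longleftrightarrow> (u, v) \<notin> P \<and> (v, u) \<notin> P"
    using permutation_graph_strict_order[OF assms] by blast
  \<comment> \<open>\<open>comparability_graph\<close> includes \<open>pair_graph\<close>, so the
    complement of the star-conflict graph must be a \<open>pair_graph\<close> too.\<close>
  then show ?thesis
    using orientation_leaf_orientation[of P] trans_leaf_orientation[of P G]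
      pair_graph_star_conflict_graph
      pair_graph.pair_graph_complement_graph[OF pair_graph_star_conflict_graph]
    unfolding cocomparability_graph_def comparability_graph_def by blast
qed

end
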